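(* Let $\succ$ and $\succ_0$ be weak order (WO) preference relations over the same relation schema such that (1) $\succ$ and $\succ_0$ are $0$-compatible; (2) $\succ$ can be represented using a real-valued function $u$; (3) $\succ_0$ can be represented using a real-valued function $u_0$. Let $\theta\in\{\cup,\triangleright,\otimes\}$. Then $\succ'\,=\,(\succ_0\,\theta\,\succ)$ is a WO preference relation that can be represented using any real-valued function $u'$ such that for all $x$ \[u'(x)=a\cdot u(x)+b\cdot u_0(x)+c,\] where $a$ and $b$ are arbitrary positive real numbers and $c$ is an arbitrary real constant.
   Context: A relation schema $R(A_1,\dots,A_k)$ assigns each attribute $A_i$ a domain $U_i$, either a countably infinite set $D$ of uninterpreted constants or the set $\mathbb{Q}$ of rational numbers; tuples are elements of $U=U_1\times\cdots\times U_k$. A preference relation over $R$ is any subset of $U\times U$ (possibly infinite). A preference relation $\succ$ is a WO if it is irreflexive, transitive, and negatively transitive: for all $x,y,z$, $(x\not\succ y\wedge y\not\succ z)$ implies $x\not\succ z$. A function $u:U\to\mathbb{R}$ represents $\succ$ iff for all tuples $t_1,t_2$: $t_1\succ t_2$ iff $u(t_1)>u(t_2)$. Union is set union; prioritized composition: $t_1(\succ_0\triangleright\succ)t_2$ iff $t_1\succ_0 t_2\vee(t_2\not\succ_0 t_1\wedge t_1\succ t_2)$; Pareto composition: $t_1(\succ_0\otimes\succ)t_2$ iff $(t_1\succ_0 t_2\wedge t_2\not\succ t_1)\vee(t_1\succ t_2\wedge t_2\not\succ_0 t_1)$. A $0$-conflict between $\succ$ and $\succ_0$ is a pair $(t_1,t_2)$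 with $t_1\succ_0 t_2$ and $t_2\succ t_1$. The relations are $0$-compatible if there are no $0$-conflicts between them. *)

theory Defs
  imports Complex_Main "HOL-Library.Countable_Set"
begin

datatype attr_domain = Uninterpreted | Rational

datatype 'd val = Const 'd | Num rat

text \<open>A relation schema is the list of the domains of its attributes; attributes are
  identified with their positions.\<close>

type_synonym schema = "attr_domain list"

type_synonym 'd tuple = "'d val list"

fun domain_values :: "'d set \<Rightarrow> attr_domain \<Rightarrow> 'd val set" where
  "domain_values D Uninterpreted = Const ` D"
| "domain_values D Rational = range Num"

text \<open>The universe \<open>U\<^sub>1 \<times> \<dots> \<times> U\<^sub>k\<close> of tuples, where \<open>D\<close> is the set of uninterpreted constants.\<close>

definition tuples :: "'d set \<Rightarrow> schema \<Rightarrow> 'd tuple set" where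
  "tuples D R = listset (map (domain_values D) R)"

text \<open>In the rest of this theory, \<open>(x, y) \<in> P\<close> stands for \<open>x \<succ> y\<close>.\<close>

definition preference_relation :: "'t set \<Rightarrow> 't rel \<Rightarrow> bool" where
  "preference_relation U P \<longleftrightarrow> P \<subseteq> U \<times> U"

definition negatively_transitive_on :: "'t set \<Rightarrow> 't rel \<Rightarrow> bool" where
  "negatively_transitive_on U P \<longleftrightarrow>
     (\<forall>x\<in>U. \<forall>y\<in>U. \<forall>z\<in>U. (x, y) \<notin> P \<and> (y, z) \<notin> P \<longrightarrow> (x, z) \<notin> P)"

definition WO_preference_relation :: "'t set \<Rightarrow> 't rel \<Rightarrow> bool" where
  "WO_preference_relation U P \<longleftrightarrow>
     preference_relation U P \<and> irrefl_on U P \<and> trans_on U P \<and> negatively_transitive_on U P"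

text \<open>HOL functions are total; only the values of \<open>u\<close> on \<open>U\<close> matter.\<close>

definition represents :: "'t set \<Rightarrow> ('t \<Rightarrow> real) \<Rightarrow> 't rel \<Rightarrow> bool" where
  "represents U u P \<longleftrightarrow> (\<forall>t\<^sub>1\<in>U. \<forall>t\<^sub>2\<in>U. (t\<^sub>1, t\<^sub>2) \<in> P \<longleftrightarrow> u t\<^sub>1 > u t\<^sub>2)"

definition prioritized_composition :: "'t rel \<Rightarrow> 't rel \<Rightarrow> 't rel" (infixr \<open>\<triangleright>\<close> 65) where
  "P\<^sub>0 \<triangleright> P = {(t\<^sub>1, t\<^sub>2). (t\<^sub>1, t\<^sub>2) \<in> P\<^sub>0 \<or> ((t\<^sub>2, t\<^sub>1) \<notin> P\<^sub>0 \<and> (t\<^sub>1, t\<^sub>2) \<in> P)}"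

definition pareto_composition :: "'t rel \<Rightarrow> 't rel \<Rightarrow> 't rel" (infixr \<open>\<otimes>\<close> 65) where
  "P\<^sub>0 \<otimes> P = {(t\<^sub>1, t\<^sub>2). ((t\<^sub>1, t\<^sub>2) \<in> P\<^sub>0 \<and> (t\<^sub>2, t\<^sub>1) \<notin> P) \<or> ((t\<^sub>1, t\<^sub>2) \<in> P \<and> (t\<^sub>2, t\<^sub>1) \<notin> P\<^sub>0)}"

definition zero_conflict :: "'t rel \<Rightarrow> 't rel \<Rightarrow> 't \<times> 't \<Rightarrow> bool" where
  "zero_conflict P P\<^sub>0 = (\<lambda>(t\<^sub>1, t\<^sub>2). (t\<^sub>1, t\<^sub>2) \<in> P\<^sub>0 \<and> (t\<^sub>2, t\<^sub>1) \<in> P)"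

definition zero_compatible :: "'t rel \<Rightarrow> 't rel \<Rightarrow> bool" where
  "zero_compatible P P\<^sub>0 \<longleftrightarrow> \<not> (\<exists>p. zero_conflict P P\<^sub>0 p)"

end

theory Submission
  imports Defs
begin

text \<open>Under \<open>0\<close>-compatibility the guards in the prioritized and Pareto compositions are
  vacuous, so all three compositions are the union. Moreover the differences of \<open>u\<close> and of
  \<open>u\<^sub>0\<close> between two tuples never have opposite signs, so a positive combination of them is
  positive iff one of them is. Being represented by a real function then makes the union a
  weak order.\<close>

lemma prioritized_composition_eq_Un:
  assumes "zero_compatible P P\<^sub>0"
  shows "P\<^sub>0 \<triangleright> P = P\<^sub>0 \<union> P"
  using assms
  by (auto simp: prioritized_composition_def zero_compatible_def zero_conflict_def)

lemma pareto_composition_eq_Un: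
  assumes "zero_compatible P P\<^sub>0"
  shows "P\<^sub>0 \<otimes> P = P\<^sub>0 \<union> P"
  using assms
  by (auto simp: pareto_composition_def zero_compatible_def zero_conflict_def)

text \<open>On \<open>U\<close> the relation is the pullback of > on the reals along
  \<open>u\<close>. Irreflexivity and transitivity are inherited from >, and negative transitivity
  is transitivity of \<le>.\<close>

lemma represents_imp_WO_preference_relation:
  assumes "preference_relation U P" and "represents U u P"
  shows "WO_preference_relation U P"
  using assms
  by (fastforce simp: WO_preference_relation_def represents_def negatively_transitive_on_def
      intro!: irrefl_onI trans_onI)

text \<open>If one of \<open>p\<close>, \<open>q\<close> is positive, the sign hypotheses make the
  other nonnegative, so nothing cancels; otherwise both summands are nonpositive. Applied with
  \<open>p\<close>, \<open>q\<close> the differences of \<open>u\<close> and of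
  \<open>u\<^sub>0\<close> between two tuples.\<close>

lemma pos_combination_pos_iff:
  fixes a b p q :: real
  assumes "a > 0" and "b > 0" and "\<not> (p > 0 \<and> q < 0)" and "\<not> (p < 0 \<and> q > 0)"
  shows "a * p + b * q > 0 \<longleftrightarrow> p > 0 \<or> q > 0"
proof (cases "p > 0 \<or> q > 0")
  case True
  then have "p \<ge> 0" "q \<ge> 0" using assms by auto
  with True \<open>a > 0\<close> \<open>b > 0\<close> show ?thesis
    by (auto intro: add_pos_nonneg add_nonneg_pos)
next
  case False
  then have "a * p \<le> 0" "b * q \<le> 0"
    using \<open>a > 0\<close> \<open>b > 0\<close> by (auto simp: mult_le_0_iff)
  with False show ?thesis by linarith
qed

lemma represents_Un:
  fixes a b c :: real
  assumes "zero_compatible P P\<^sub>0" and "represents U u P" and "represents U u\<^sub>0 P\<^sub>0"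
    and "a > 0" and "b > 0" and u': "\<And>x. x \<in> U \<Longrightarrow> u' x = a * u x + b * u\<^sub>0 x + c"
  shows "represents U u' (P\<^sub>0 \<union> P)"
  unfolding represents_def
proof (intro ballI)
  fix x y assume xy: "x \<in> U" "y \<in> U"
  then have P: "(x, y) \<in> P \<longleftrightarrow> u x > u y" "(y, x) \<in> P \<longleftrightarrow> u y > u x"
    and P\<^sub>0: "(x, y) \<in> P\<^sub>0 \<longleftrightarrow> u\<^sub>0 x > u\<^sub>0 y" "(y, x) \<in> P\<^sub>0 \<longleftrightarrow> u\<^sub>0 y > u\<^sub>0 x"
    using assms(2,3) by (auto simp: represents_def)
  \<comment> \<open>Compatibility is used for both orders of the pair: each excludes one of the two
    combinations of opposite signs.\<close>
  have "\<not> ((x, y) \<in> P\<^sub>0 \<and> (y, x) \<in> P)" "\<not> ((y, x) \<in> P\<^sub>0 \<and> (x, y) \<in> P)"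
    using assms(1) by (auto simp: zero_compatible_def zero_conflict_def)
  then have "a * (u x - u y) + b * (u\<^sub>0 x - u\<^sub>0 y) > 0 \<longleftrightarrow> u x - u y > 0 \<or> u\<^sub>0 x - u\<^sub>0 y > 0"
    using \<open>a > 0\<close> \<open>b > 0\<close> P P\<^sub>0 by (intro pos_combination_pos_iff) auto
  \<comment> \<open>The constant \<open>c\<close> cancels in the difference.\<close>
  moreover have "u' x - u' y = a * (u x - u y) + b * (u\<^sub>0 x - u\<^sub>0 y)"
    using xy by (simp add: u' algebra_simps)
  ultimately show "(x, y) \<in> P\<^sub>0 \<union> P \<longleftrightarrow> u' x > u' y"
    using P P\<^sub>0 by auto
qed

theorem theorem6:
  fixes D :: "'d set"
    and R :: schema
    and U :: "'d tuple set"
    and P P\<^sub>0 :: "'d tuple rel"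
    and u u\<^sub>0 :: "'d tuple \<Rightarrow> real"
    and \<theta> :: "'d tuple rel \<Rightarrow> 'd tuple rel \<Rightarrow> 'd tuple rel"
  assumes "countable D" and "infinite D"
    and "U = tuples D R"
    and "WO_preference_relation U P"
    and "WO_preference_relation U P\<^sub>0"
    and "zero_compatible P P\<^sub>0"
    and "represents U u P"
    and "represents U u\<^sub>0 P\<^sub>0"
    and "\<theta> \<in> {(\<union>), (\<triangleright>), (\<otimes>)}"
  shows "WO_preference_relation U (\<theta> P\<^sub>0 P) \<and>
         (\<forall>(u' :: 'd tuple \<Rightarrow> real) (a :: real) (b :: real) (c :: real).
            a > 0 \<and> b > 0 \<and> (\<forall>x\<in>U. u' x = a * u x + b * u\<^sub>0 x + c)
            \<longrightarrow> represents U u' (\<theta> P\<^sub>0 P))"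
proof -
  have \<theta>: "\<theta> P\<^sub>0 P = P\<^sub>0 \<union> P"
    using assms(6,9)
    by (auto simp: prioritized_composition_eq_Un pareto_composition_eq_Un)
  have rep: "represents U u' (\<theta> P\<^sub>0 P)"
    if "a > 0" "b > 0" "\<And>x. x \<in> U \<Longrightarrow> u' x = a * u x + b * u\<^sub>0 x + c" for u' and a b c :: real
    unfolding \<theta> by (rule represents_Un[OF assms(6-8) that])
  \<comment> \<open>\<open>represents\<close> constrains only pairs inside \<open>U\<close>, so
    containment in \<open>U \<times> U\<close> is taken from the two given relations.\<close>
  have "preference_relation U (\<theta> P\<^sub>0 P)"
    using assms(4,5) by (auto simp: \<theta> WO_preference_relation_def preference_relation_def)
  \<comment> \<open>One representing function suffices for the weak order; the plain sum of
    \<open>u\<close> and \<open>u\<^sub>0\<close> is the simplest instance.\<close>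
  moreover have "represents U (\<lambda>x. 1 * u x + 1 * u\<^sub>0 x + 0) (\<theta> P\<^sub>0 P)"
    by (rule rep[of 1 1]) auto
  ultimately have "WO_preference_relation U (\<theta> P\<^sub>0 P)"
    by (rule represents_imp_WO_preference_relation)
  with rep show ?thesis by blast
qed

end
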